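(* Let $0 < a < \ln 2$. Then $$M(a) = \frac{\gamma}{a} + \frac{a + \ln(1-e^{-a}) + \Gamma(0,a)}{1-e^{-a}} + \frac{1}{1-e^{-a}} \int_{0}^{1} e^{-at} \psi(t+1)\, dt .$$
   Context: For real $a$, $$M(a) := \frac{4}{\pi}\int_0^{\pi/2} \frac{x^2\,dx}{x^2+\ln^2(2e^{-a}\cos x)},$$ where $\ln^2(y)=(\ln y)^2$. Here $\gamma=\lim_{n\to\infty}\left(\sum_{k=1}^n \frac1k-\ln n\right)$ is Euler's constant, $\psi(x)=\frac{d}{dx}\ln\Gamma(x)$ is the digamma function, and $\Gamma(0,a)=\int_a^\infty \frac{e^{-u}}{u}\,du$ is the incomplete gamma function. *)

theory Defs
  imports "HOL-Analysis.Analysis"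
begin

(* At x = pi/2 the library value ln 0 = 0 enters the integrand; a single point does not affect
   the integral. *)
definition M :: "real \<Rightarrow> real" where
  "M a = 4 / pi * integral {0..pi/2} (\<lambda>x. x\<^sup>2 / (x\<^sup>2 + (ln (2 * exp (-a) * cos x))\<^sup>2))"

(* The incomplete gamma function \<Gamma>(0, a). *)
definition Gamma0 :: "real \<Rightarrow> real" where
  "Gamma0 a = integral {a..} (\<lambda>u. exp (-u) / u)"

end

theory Submission
  imports Defs "HOL-Complex_Analysis.Complex_Analysis"
begin

text \<open>
  Put \<open>z = e\<^sup>2\<^sup>i\<^sup>x\<close>. Then \<open>Ln (1 + z) - a = ln (2 e\<^sup>-\<^sup>a cos x) + i x\<close>, so the integrand of \<open>M a\<close> is half the
  real part of \<open>log z / (Ln (1 + z) - a)\<close>, and \<open>M a\<close> is the mean of this real part over the unit circle. For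
  \<open>0 < a < ln 2\<close> the kernel \<open>1 / (Ln (1 + z) - a)\<close> has one singularity in the unit disc, a
  simple pole at \<open>p = e\<^sup>a - 1\<close>; this pole is the source of the term that is logarithmic in
  \<open>1 - e\<^sup>-\<^sup>a\<close>.

  The first half of the proof is complex analysis. If \<open>H\<close> is holomorphic in the disc and continuous up to
  the boundary, then the mean of \<open>i \<theta> H(e\<^sup>i\<^sup>\<theta>)\<close> over \<open>-\<pi> < \<theta> < \<pi>\<close> equals the integral of
  \<open>(H(-t) - H(0)) / t\<close> over \<open>0 < t < 1\<close> (\<open>disc_sawtooth_moment\<close>): the jump of \<open>\<theta>\<close> at the
  point \<open>-1\<close> replaces a contour around the cut of \<open>log z\<close>. To apply this, the pole at \<open>p\<close> is moved to its
  mirror image \<open>1/p\<close> outside the disc (\<open>reflected_kernel\<close>). On the circle this adds a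
  real function to the kernel, which does not affect the real part of \<open>i \<theta> H\<close>. The result
  (\<open>M_as_radial_integral\<close>) expresses \<open>M a\<close> by the real integral of
  \<open>(1/a - 1/(a - ln (1 - t))) / t\<close> and an elementary residue term.

  The second half is real analysis. Both factors of the radial integrand, at \<open>y = 1 - t\<close>, come from the
  function \<open>1 - y\<^sup>s\<close>: its Laplace transform in \<open>s\<close> is \<open>1/a - 1/(a - ln y)\<close>, whereas the integral of
  \<open>(1 - y\<^sup>s) / (1 - y)\<close> over \<open>0 < y < 1\<close> is \<open>\<psi>(s + 1) + \<gamma>\<close>. Tonelli's theorem thus identifies the
  radial integral with the Laplace transform of \<open>\<psi>(s + 1) + \<gamma>\<close> (\<open>Laplace_Digamma_Tonelli\<close>).
  The functional equation of \<open>\<psi>\<close> under \<open>s \<mapsto> s + 1\<close> then reduces this Laplace integral to one over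
  \<open>0 \<le> s \<le> 1\<close> at the price of the incomplete gamma function (\<open>Laplace_Digamma_split\<close>).
\<close>

section \<open>The sawtooth moment of a holomorphic function on the circle\<close>

text \<open>
  The primitive exists on the closed disc, so it can be integrated along the boundary circle itself without
  a limit of smaller radii.
\<close>
lemma divided_difference_primitive:
  fixes H :: "complex \<Rightarrow> complex"
  assumes cont: "continuous_on (cball 0 1) H" and hol: "H holomorphic_on ball 0 1"
  obtains K k where
    "\<And>z. z \<in> cball 0 1 \<Longrightarrow> (K has_field_derivative k z) (at z within cball 0 1)"
    "\<And>z. z \<noteq> 0 \<Longrightarrow> k z = (H z - H 0) / z"
proof -
  define k where "k = (\<lambda>z. if z = 0 then deriv H 0 else (H z - H 0) / (z - 0))"
  have holk: "k holomorphic_on ball 0 1"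
    unfolding k_def by (rule pole_lemma[OF hol]) simp
  have "continuous (at z within cball 0 1) k" if z: "z \<in> cball 0 1" for z
  proof (cases "z = 0")
    case True
    have "isCont k 0"
      using holomorphic_on_imp_continuous_on[OF holk]
      by (subst (asm) continuous_on_eq_continuous_at) auto
    then show ?thesis
      using True continuous_at_imp_continuous_at_within by blast
  next
    case False
    have "continuous (at z within cball 0 1) (\<lambda>z. (H z - H 0) / z)"
      using cont z False
      by (intro continuous_intros) (auto simp: continuous_on_eq_continuous_within)
    moreover have "\<forall>\<^sub>F w in at z within cball 0 1. (H w - H 0) / w = k w"
      using False by (auto simp: k_def eventually_at intro!: exI[of _ "norm z"])
    ultimately show ?thesis
      using False by (auto simp: continuous_within k_def elim: tendsto_cong[THEN iffD1, rotated])
  qed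
  then have "continuous_on (cball 0 1) k"
    by (simp add: continuous_on_eq_continuous_within)
  moreover have "k field_differentiable at z" if "z \<in> interior (cball 0 1) - {}" for z
    using that holk by (auto intro: holomorphic_on_imp_differentiable_at[of k "ball 0 1"])
  ultimately obtain K where
    "\<And>z. z \<in> cball 0 1 \<Longrightarrow> (K has_field_derivative k z) (at z within cball 0 1)"
    using holomorphic_convex_primitive[of "cball 0 1" "{}" k] by auto
  then show ?thesis by (rule that) (simp_all add: k_def)
qed

lemma has_vector_derivative_cis_compose:
  assumes "\<And>z. z \<in> cball 0 1 \<Longrightarrow> (K has_field_derivative k z) (at z within cball 0 1)"
  shows "((\<lambda>\<theta>. K (cis \<theta>)) has_vector_derivative \<i> * cis \<theta> * k (cis \<theta>)) (at \<theta> within T)"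
proof -
  have 1: "(cis has_vector_derivative \<i> * cis \<theta>) (at \<theta> within T)"
    unfolding has_vector_derivative_complex_iff
    by (auto intro!: derivative_eq_intros simp: has_real_derivative_iff_has_vector_derivative[symmetric] has_field_derivative_at_within)
  have 2: "(K has_field_derivative k (cis \<theta>)) (at (cis \<theta>) within cis ` T)"
    by (rule DERIV_subset[OF assms]) auto
  show ?thesis
    using field_vector_diff_chain_within[OF 1 2] by (simp add: o_def)
qed

lemma cis_minus_pi: "cis (- pi) = - 1"
  by (simp add: complex_eq_iff)

text \<open>
  Along the circle, \<open>i (H(e\<^sup>i\<^sup>\<theta>) - H(0))\<close> is the derivative of the primitive of the divided difference
  of \<open>H\<close>, hence its integral over a period vanishes.
\<close>
lemma disc_mean_value:
  fixes H :: "complex \<Rightarrow> complex"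
  assumes cont: "continuous_on (cball 0 1) H" and hol: "H holomorphic_on ball 0 1"
  shows "((\<lambda>\<theta>. H (cis \<theta>)) has_integral 2 * pi * H 0) {-pi..pi}"
proof -
  obtain K k where K: "\<And>z. z \<in> cball 0 1 \<Longrightarrow> (K has_field_derivative k z) (at z within cball 0 1)"
    and k: "\<And>z. z \<noteq> 0 \<Longrightarrow> k z = (H z - H 0) / z"
    using divided_difference_primitive[OF assms] by metis
  have "((\<lambda>\<theta>. \<i> * cis \<theta> * k (cis \<theta>)) has_integral K (cis pi) - K (cis (-pi))) {-pi..pi}"
    by (rule fundamental_theorem_of_calculus) (auto intro: has_vector_derivative_cis_compose[OF K])
  then have "((\<lambda>\<theta>. \<i> * (H (cis \<theta>) - H 0)) has_integral 0) {-pi..pi}"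
    by (simp add: k cis_minus_pi mult.assoc)
  then have "((\<lambda>\<theta>. -\<i> * (\<i> * (H (cis \<theta>) - H 0))) has_integral -\<i> * 0) {-pi..pi}"
    by (rule has_integral_mult_right)
  then have "((\<lambda>\<theta>. H (cis \<theta>) - H 0) has_integral 0) {-pi..pi}"
    by (simp add: mult.assoc[symmetric])
  from has_integral_add[OF this has_integral_const_real[of "H 0" "-pi" pi]]
  show ?thesis by (simp add: scaleR_conv_of_real)
qed

text \<open>
  Let \<open>K\<close> be a primitive of the divided difference of \<open>H\<close>. The derivative of \<open>\<theta> K(e\<^sup>i\<^sup>\<theta>)\<close> is
  \<open>K(e\<^sup>i\<^sup>\<theta>) + i \<theta> (H(e\<^sup>i\<^sup>\<theta>) - H(0))\<close>. Its integral is \<open>2 \<pi> K(-1)\<close>, of which the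
  first summand contributes \<open>2 \<pi> K(0)\<close> by the mean value property. The difference
  \<open>K(-1) - K(0)\<close> is the integral of the divided difference along the radius from \<open>0\<close> to \<open>-1\<close>.
\<close>
lemma disc_sawtooth_moment:
  fixes H :: "complex \<Rightarrow> complex"
  assumes cont: "continuous_on (cball 0 1) H" and hol: "H holomorphic_on ball 0 1"
  obtains I :: complex where
    "((\<lambda>t. (H (- of_real t) - H 0) / of_real t) has_integral I) {0..1}"
    "((\<lambda>\<theta>. \<i> * of_real \<theta> * H (cis \<theta>)) has_integral 2 * pi * I) {-pi..pi}"
proof -
  obtain K k where K: "\<And>z. z \<in> cball 0 1 \<Longrightarrow> (K has_field_derivative k z) (at z within cball 0 1)"
    and k: "\<And>z. z \<noteq> 0 \<Longrightarrow> k z = (H z - H 0) / z"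
    using divided_difference_primitive[OF assms] by metis
  have "continuous_on (cball 0 1) K"
    using K DERIV_continuous continuous_on_eq_continuous_within by blast
  moreover have "(K has_field_derivative k z) (at z)" if "z \<in> ball 0 1" for z
    using DERIV_subset[OF K, of z "ball 0 1"] that by (simp add: at_within_open[OF that])
  then have "K holomorphic_on ball 0 1"
    by (meson holomorphic_onI field_differentiable_def has_field_derivative_at_within)
  ultimately have mean: "((\<lambda>\<theta>. K (cis \<theta>)) has_integral 2 * pi * K 0) {-pi..pi}"
    by (rule disc_mean_value)

  have "((\<lambda>t. K (- of_real t)) has_vector_derivative - 1 * k (- of_real t)) (at t within {0..1})"
    if t: "t \<in> {0..1}" for t
  proof -
    have 1: "((\<lambda>t. - complex_of_real t) has_vector_derivative - 1) (at t within {0..1})"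
      unfolding has_vector_derivative_complex_iff by (auto intro!: derivative_eq_intros)
    have 2: "(K has_field_derivative k (- of_real t)) (at (- of_real t) within (\<lambda>t. - complex_of_real t) ` {0..1})"
      by (rule DERIV_subset[OF K]) (use t in auto)
    show ?thesis
      using field_vector_diff_chain_within[OF 1 2] by (simp add: o_def)
  qed
  then have "((\<lambda>t. - 1 * k (- of_real t)) has_integral K (- of_real 1) - K (- of_real 0)) {0..1}"
    by (intro fundamental_theorem_of_calculus) auto
  then have radial: "((\<lambda>t. (H (- of_real t) - H 0) / of_real t) has_integral K (-1) - K 0) {0..1}"
    unfolding of_real_1 of_real_0 minus_zero
    by (rule has_integral_spike[of "{0}", rotated -1]) (auto simp: k minus_divide_left)

  have "((\<lambda>\<theta>. complex_of_real \<theta>) has_vector_derivative 1) (at \<theta> within {-pi..pi})" for \<theta>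
    unfolding has_vector_derivative_complex_iff by (auto intro!: derivative_eq_intros)
  from has_vector_derivative_mult[OF this has_vector_derivative_cis_compose[OF K]]
  have "((\<lambda>\<theta>. of_real \<theta> * K (cis \<theta>)) has_vector_derivative
           of_real \<theta> * (\<i> * cis \<theta> * k (cis \<theta>)) + 1 * K (cis \<theta>)) (at \<theta> within {-pi..pi})" for \<theta> .
  then have "((\<lambda>\<theta>. of_real \<theta> * (\<i> * cis \<theta> * k (cis \<theta>)) + 1 * K (cis \<theta>)) has_integral
      of_real pi * K (cis pi) - of_real (-pi) * K (cis (-pi))) {-pi..pi}"
    by (intro fundamental_theorem_of_calculus) auto
  then have "((\<lambda>\<theta>. \<i> * \<theta> * (H (cis \<theta>) - H 0) + K (cis \<theta>)) has_integral 2 * pi * K (-1)) {-pi..pi}"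
    by (simp add: k cis_minus_pi mult_ac)
  from has_integral_diff[OF this mean]
  have 1: "((\<lambda>\<theta>. \<i> * \<theta> * (H (cis \<theta>) - H 0)) has_integral 2 * pi * (K (-1) - K 0)) {-pi..pi}"
    by (simp add: algebra_simps)
  have "((\<lambda>\<theta>. \<i> * of_real \<theta> * H 0) has_integral
      \<i> * of_real (pi\<^sup>2 / 2) * H 0 - \<i> * of_real ((-pi)\<^sup>2 / 2) * H 0) {-pi..pi}"
  proof (rule fundamental_theorem_of_calculus)
    fix \<theta> :: real
    have "((\<lambda>\<theta>. \<i> * of_real (\<theta>\<^sup>2 / 2)) has_vector_derivative \<i> * of_real \<theta>) (at \<theta> within {-pi..pi})"
      unfolding has_vector_derivative_complex_iff by (auto intro!: derivative_eq_intros)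
    then show "((\<lambda>\<theta>. \<i> * of_real (\<theta>\<^sup>2 / 2) * H 0) has_vector_derivative \<i> * of_real \<theta> * H 0)
        (at \<theta> within {-pi..pi})"
      by (rule has_vector_derivative_mult_left)
  qed simp
  from has_integral_add[OF 1 this]
  have "((\<lambda>\<theta>. \<i> * of_real \<theta> * H (cis \<theta>)) has_integral 2 * pi * (K (-1) - K 0)) {-pi..pi}"
    by (simp add: algebra_simps)
  with radial show ?thesis by (rule that)
qed

section \<open>The kernel with its pole reflected in the unit circle\<close>

text \<open>
  Removing the singularity twice: \<open>q(z) = f(z) / (z - p)\<close> extends to a zero-free function with
  \<open>q(p) = c\<close>, and \<open>g\<close> is the divided difference of \<open>1 / q\<close> at \<open>p\<close>.
\<close>
lemma reciprocal_minus_simple_pole: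
  fixes f :: "complex \<Rightarrow> complex"
  assumes hol: "f holomorphic_on S" and S: "open S" "p \<in> S"
    and zero: "f p = 0" and c: "(f has_field_derivative c) (at p)" "c \<noteq> 0"
    and nz: "\<And>z. z \<in> S \<Longrightarrow> z \<noteq> p \<Longrightarrow> f z \<noteq> 0"
  obtains g where "g holomorphic_on S"
    "\<And>z. z \<in> S \<Longrightarrow> z \<noteq> p \<Longrightarrow> g z = 1 / f z - 1 / (c * (z - p))"
proof -
  have p: "p \<in> interior S"
    using S by (simp add: interior_open)
  define q where "q = (\<lambda>z. if z = p then deriv f p else (f z - f p) / (z - p))"
  define r where "r = (\<lambda>z. inverse (q z))"
  have q: "q p = c"
    using c by (simp add: q_def DERIV_imp_deriv)
  have "q holomorphic_on S"
    unfolding q_def by (rule pole_lemma[OF hol p])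
  moreover have "q z \<noteq> 0" if "z \<in> S" for z
    using that q c nz by (cases "z = p") (auto simp: q_def zero)
  ultimately have "r holomorphic_on S"
    unfolding r_def by (intro holomorphic_intros)
  then have "(\<lambda>z. if z = p then deriv r p else (r z - r p) / (z - p)) holomorphic_on S"
    by (rule pole_lemma[OF _ p])
  then show ?thesis
  proof (rule that)
    fix z assume z: "z \<in> S" "z \<noteq> p"
    then have "f z \<noteq> 0" "z - p \<noteq> 0"
      using nz by auto
    moreover have "r z = (z - p) / f z" "r p = 1 / c"
      using z by (simp_all add: r_def q inverse_eq_divide) (simp add: q_def zero)
    moreover have "((z - p) / f z - 1 / c) / (z - p) = 1 / f z - 1 / (c * (z - p))"
      if "f z \<noteq> 0" "z - p \<noteq> 0"
      using that \<open>c \<noteq> 0\<close> by (simp add: divide_simps)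
    ultimately show "(if z = p then deriv r p else (r z - r p) / (z - p)) = 1 / f z - 1 / (c * (z - p))"
      using z by simp
  qed
qed

text \<open>
  The branch point \<open>-1\<close> lies on the unit circle. The real part of \<open>Ln (1 + z)\<close> tends to \<open>-\<infinity>\<close> there, so the
  kernel extends continuously by \<open>0\<close>.
\<close>
lemma tendsto_inverse_Ln_minus_at_branch_point:
  "((\<lambda>z. 1 / (Ln (1 + z) - of_real a)) \<longlongrightarrow> 0) (at (-1))"
proof -
  have "filterlim (\<lambda>z. norm (1 + z :: complex)) (at_right 0) (at (-1))"
    unfolding filterlim_at
    by (auto simp: eventually_at_filter add_eq_0_iff intro!: tendsto_eq_intros)
  from filterlim_compose[OF ln_at_0 this]
  have "filterlim (\<lambda>z. a - ln (norm (1 + z :: complex))) at_top (at (-1))"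
    by (simp add: filterlim_uminus_at_bot filterlim_tendsto_add_at_top[OF tendsto_const] diff_conv_add_uminus
        del: add_uminus_conv_diff)
  then have "filterlim (\<lambda>z. norm (Ln (1 + z) - of_real a)) at_top (at (-1))"
  proof (rule filterlim_at_top_mono)
    have "a - ln (norm (1 + z)) \<le> norm (Ln (1 + z) - of_real a)" if "z \<noteq> -1" for z :: complex
      using abs_Re_le_cmod[of "Ln (1 + z) - of_real a"] that by (simp add: add_eq_0_iff)
    then show "\<forall>\<^sub>F z in at (-1). a - ln (norm (1 + z)) \<le> norm (Ln (1 + z) - complex_of_real a)"
      by (simp add: eventually_at_filter)
  qed
  then have "filterlim (\<lambda>z. Ln (1 + z) - of_real a) at_infinity (at (-1))"
    by (simp add: filterlim_at_infinity_conv_norm_at_top)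
  from tendsto_inverse_0[THEN filterlim_compose, OF this] show ?thesis
    by (simp add: inverse_eq_divide)
qed

lemma disc_slit_plane:
  fixes z :: complex
  assumes "z \<in> cball 0 1" "z \<noteq> -1"
  shows "1 + z \<notin> \<real>\<^sub>\<le>\<^sub>0"
proof
  assume "1 + z \<in> \<real>\<^sub>\<le>\<^sub>0"
  then have "Re z \<le> -1" "Im z = 0"
    by (auto simp: complex_nonpos_Reals_iff)
  moreover have "-1 \<le> Re z"
    using assms abs_Re_le_cmod[of z] by simp
  ultimately show False
    using assms by (auto simp: complex_eq_iff)
qed

text \<open>
  The residue of the kernel at \<open>p = e\<^sup>a - 1\<close> is \<open>e\<^sup>a = 1 + p\<close>. The last summand is
  \<open>(1 + p) / (cnj z - p)\<close> when \<open>|z| = 1\<close>, that is, the complex conjugate of the subtracted polar part; it is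
  holomorphic on the closed disc because \<open>|p| < 1\<close>.
\<close>
lemma reflected_kernel:
  fixes a :: real
  assumes a: "0 < a" "a < ln 2"
  defines "p \<equiv> exp a - 1"
  obtains H :: "complex \<Rightarrow> complex" where
    "continuous_on (cball 0 1) H" "H holomorphic_on ball 0 1"
    "\<forall>z \<in> cball 0 1 - {-1, of_real p}.
       H z = 1 / (Ln (1 + z) - of_real a)
           - (1 + of_real p) * (1 / (z - of_real p) + z / (1 - of_real p * z))"
proof -
  have p: "0 < p" "p < 1"
    using a by (simp_all add: p_def) (metis exp_less_cancel_iff exp_ln zero_less_numeral)
  define S where "S = {z :: complex. 1 + z \<notin> \<real>\<^sub>\<le>\<^sub>0}"
  define f where "f = (\<lambda>z. Ln (1 + z) - of_real a)"
  have cball_S: "cball 0 1 - {-1} \<subseteq> S"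
    using disc_slit_plane by (auto simp: S_def)
  have "open ((\<lambda>z. 1 + z) -` (- \<real>\<^sub>\<le>\<^sub>0 :: complex set))"
    by (intro open_vimage continuous_intros) (simp add: open_Compl)
  then have S: "open S"
    by (simp add: S_def vimage_def)
  have pS: "of_real p \<in> S"
    using p by (intro subsetD[OF cball_S]) (auto simp: complex_eq_iff)
  have "f holomorphic_on S"
    unfolding f_def S_def by (intro holomorphic_intros) auto
  moreover have "f (of_real p) = 0"
  proof -
    have "Ln (1 + of_real p) = Ln (of_real (exp a))"
      by (simp add: p_def)
    also have "\<dots> = of_real a"
      by (subst Ln_of_real) auto
    finally show ?thesis
      by (simp add: f_def)
  qed
  moreover have "(f has_field_derivative of_real (1 / (1 + p))) (at (of_real p))"
    unfolding f_def using pS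
    by (auto simp: S_def divide_inverse intro!: derivative_eq_intros)
  moreover have "complex_of_real (1 / (1 + p)) \<noteq> 0"
    using p by (auto simp: complex_eq_iff)
  moreover have "f z \<noteq> 0" if "z \<in> S" "z \<noteq> of_real p" for z
  proof
    assume "f z = 0"
    moreover have "1 + z \<noteq> 0"
      using that by (auto simp: S_def)
    ultimately have "1 + z = exp (of_real a)"
      using exp_Ln[of "1 + z"] by (simp add: f_def)
    then show False
      using that by (simp add: p_def exp_of_real algebra_simps)
  qed
  ultimately obtain g where g: "g holomorphic_on S"
    and g_eq: "\<And>z. z \<in> S \<Longrightarrow> z \<noteq> of_real p \<Longrightarrow>
      g z = 1 / f z - 1 / (of_real (1 / (1 + p)) * (z - of_real p))"
    using reciprocal_minus_simple_pole[of f S "of_real p" "of_real (1 / (1 + p))"] S pS by metis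

  \<comment> \<open>At \<open>-1\<close> the kernel itself tends to \<open>0\<close> and the subtracted polar part equals
    \<open>(1 + p) / (-1 - p) = -1\<close>, which leaves the value \<open>1\<close>.\<close>
  define G where "G = (\<lambda>z. if z = -1 then 1 else g z)"
  have nz: "1 - of_real p * z \<noteq> 0" if "z \<in> cball 0 1" for z :: complex
  proof
    assume "1 - of_real p * z = 0"
    then have "norm (of_real p * z) = 1"
      by simp
    moreover have "norm (of_real p * z) \<le> p * 1"
      using that p unfolding norm_mult by (intro mult_mono) auto
    ultimately show False
      using p by simp
  qed
  have "continuous (at z within cball 0 1) G" if z: "z \<in> cball 0 1" for z
  proof (cases "z = -1")
    case True
    have "((\<lambda>z. 1 / f z - 1 / (of_real (1 / (1 + p)) * (z - of_real p))) \<longlongrightarrow>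
        0 - 1 / (of_real (1 / (1 + p)) * ((-1) - of_real p))) (at (-1))"
      unfolding f_def
      by (intro tendsto_intros tendsto_inverse_Ln_minus_at_branch_point)
         (use p in \<open>auto simp: complex_eq_iff\<close>)
    moreover have "0 - 1 / (of_real (1 / (1 + p)) * ((-1) - of_real p)) = (1 :: complex)"
    proof -
      have "complex_of_real (1 + p) \<noteq> 0"
        using p by (subst of_real_eq_0_iff) simp
      then show ?thesis
        by (simp add: divide_simps add_eq_0_iff)
    qed
    ultimately have "((\<lambda>z. 1 / f z - 1 / (of_real (1 / (1 + p)) * (z - of_real p))) \<longlongrightarrow> 1) (at (-1))"
      by (simp only:)
    then have "((\<lambda>z. 1 / f z - 1 / (of_real (1 / (1 + p)) * (z - of_real p))) \<longlongrightarrow> 1)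
        (at (-1) within cball 0 1)"
      by (rule tendsto_within_subset) simp
    moreover have "\<forall>\<^sub>F w in at (-1) within cball 0 1.
        1 / f w - 1 / (of_real (1 / (1 + p)) * (w - of_real p)) = G w"
      unfolding eventually_at
    proof (intro exI[of _ 1] conjI ballI impI)
      fix w :: complex assume w: "w \<in> cball 0 1" "w \<noteq> -1 \<and> dist w (-1) < 1"
      then have "norm (w + 1) < 1"
        by (simp add: dist_norm)
      then have "Re w < 0"
        using abs_Re_le_cmod[of "w + 1"] unfolding plus_complex.sel one_complex.sel by linarith
      then have "w \<noteq> of_real p"
        using p by auto
      moreover have "w \<in> S"
        using w cball_S by blast
      ultimately show "1 / f w - 1 / (of_real (1 / (1 + p)) * (w - of_real p)) = G w"
        using w g_eq by (simp add: G_def)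
    qed simp
    ultimately have "(G \<longlongrightarrow> 1) (at (-1) within cball 0 1)"
      by (rule tendsto_cong[THEN iffD1, rotated])
    then show ?thesis
      by (simp add: True continuous_within G_def)
  next
    case False
    then have "z \<in> S"
      using z cball_S by blast
    then have "isCont g z"
      using holomorphic_on_imp_continuous_on[OF g] S by (simp add: continuous_on_eq_continuous_at)
    moreover have "\<forall>\<^sub>F w in nhds z. g w = G w"
      using t1_space_nhds[OF False] by eventually_elim (auto simp: G_def)
    ultimately have "isCont G z"
      by (simp only: isCont_cong)
    then show ?thesis
      by (rule continuous_at_imp_continuous_at_within)
  qed
  then have contG: "continuous_on (cball 0 1) G"
    by (simp add: continuous_on_eq_continuous_within)
  have "g holomorphic_on ball 0 1"
    using g by (rule holomorphic_on_subset) (use cball_S in auto)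
  then have holG: "G holomorphic_on ball 0 1"
    by (rule holomorphic_transform) (auto simp: G_def)
  show ?thesis
  proof (rule that[of "\<lambda>z. G z - (1 + of_real p) * z / (1 - of_real p * z)"])
    show "continuous_on (cball 0 1) (\<lambda>z. G z - (1 + of_real p) * z / (1 - of_real p * z))"
      by (intro continuous_intros contG) (use nz in auto)
    show "(\<lambda>z. G z - (1 + of_real p) * z / (1 - of_real p * z)) holomorphic_on ball 0 1"
      by (intro holomorphic_intros holG) (use nz in auto)
    show "\<forall>z \<in> cball 0 1 - {-1, of_real p}.
       G z - (1 + of_real p) * z / (1 - of_real p * z) = 1 / (Ln (1 + z) - of_real a)
           - (1 + of_real p) * (1 / (z - of_real p) + z / (1 - of_real p * z))"
    proof
      fix z :: complex assume z: "z \<in> cball 0 1 - {-1, of_real p}"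
      have "z \<in> S"
        using z cball_S by blast
      then have "G z = 1 / f z - 1 / (of_real (1 / (1 + p)) * (z - of_real p))"
        using z g_eq by (simp add: G_def)
      then show "G z - (1 + of_real p) * z / (1 - of_real p * z) = 1 / (Ln (1 + z) - of_real a)
             - (1 + of_real p) * (1 / (z - of_real p) + z / (1 - of_real p * z))"
        by (simp add: f_def algebra_simps)
    qed
  qed
qed

section \<open>The integral over the circle as a radial integral\<close>

lemma Ln_one_plus_cis:
  assumes "\<bar>\<theta>\<bar> < pi"
  shows "Ln (1 + cis \<theta>) = Complex (ln (2 * cos (\<theta> / 2))) (\<theta> / 2)"
proof (rule Ln_unique)
  have "0 < cos (\<theta> / 2)"
    using assms by (intro cos_gt_zero_pi) auto
  then have "exp (Complex (ln (2 * cos (\<theta> / 2))) (\<theta> / 2)) = of_real (2 * cos (\<theta> / 2)) * cis (\<theta> / 2)"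
    by (simp add: exp_eq_polar flip: exp_of_real)
  also have "\<dots> = 1 + cis \<theta>"
    using sin_double[of "\<theta> / 2"] cos_double_cos[of "\<theta> / 2"]
    by (simp add: complex_eq_iff power2_eq_square)
  finally show "exp (Complex (ln (2 * cos (\<theta> / 2))) (\<theta> / 2)) = 1 + cis \<theta>" .
qed (use assms in auto)

text \<open>
  The polar part and its reflection are complex conjugates on the circle; their sum is real and drops out.
\<close>
lemma Re_kernel_on_circle:
  fixes a p \<theta> :: real
  assumes \<theta>: "\<bar>\<theta>\<bar> < pi"
  shows "Re (\<i> * of_real \<theta> * (1 / (Ln (1 + cis \<theta>) - of_real a)
           - (1 + of_real p) * (1 / (cis \<theta> - of_real p) + cis \<theta> / (1 - of_real p * cis \<theta>))))
       = 2 * ((\<theta>/2)\<^sup>2 / ((\<theta>/2)\<^sup>2 + (ln (2 * exp (-a) * cos (\<theta>/2)))\<^sup>2))"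
proof -
  let ?L = "ln (2 * exp (-a) * cos (\<theta>/2))"
  have "0 < cos (\<theta> / 2)"
    using \<theta> by (intro cos_gt_zero_pi) auto
  then have "Ln (1 + cis \<theta>) - of_real a = Complex ?L (\<theta> / 2)"
    unfolding Ln_one_plus_cis[OF \<theta>] by (simp add: complex_eq_iff ln_mult ln_div)
  moreover have "Re (\<i> * of_real \<theta> * (1 / Complex L (\<theta> / 2))) = 2 * ((\<theta>/2)\<^sup>2 / ((\<theta>/2)\<^sup>2 + L\<^sup>2))" for L
  proof -
    have "Im (1 / Complex L (\<theta> / 2)) = - (\<theta> / 2) / (L\<^sup>2 + (\<theta> / 2)\<^sup>2)"
      by (simp add: Im_divide)
    moreover have "Re (\<i> * of_real \<theta> * w) = - (\<theta> * Im w)" for w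
      by simp
    ultimately have "Re (\<i> * of_real \<theta> * (1 / Complex L (\<theta> / 2))) = \<theta> * (\<theta> / 2) / (L\<^sup>2 + (\<theta> / 2)\<^sup>2)"
      by (simp only:) simp
    also have "\<theta> * (\<theta> / 2) = 2 * (\<theta> / 2)\<^sup>2"
      by (simp add: power2_eq_square)
    finally show ?thesis
      by (simp add: add.commute)
  qed
  ultimately have main: "Re (\<i> * of_real \<theta> * (1 / (Ln (1 + cis \<theta>) - of_real a)))
      = 2 * ((\<theta>/2)\<^sup>2 / ((\<theta>/2)\<^sup>2 + ?L\<^sup>2))"
    by simp
  have "cnj (cis \<theta>) = 1 / cis \<theta>"
    by (simp add: cis_cnj flip: inverse_eq_divide)
  moreover have "1 / cis \<theta> - of_real p = (1 - of_real p * cis \<theta>) / cis \<theta>"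
    by (simp add: diff_divide_distrib)
  ultimately have "cis \<theta> / (1 - of_real p * cis \<theta>) = cnj (1 / (cis \<theta> - of_real p))"
    by simp
  then have "Im (1 / (cis \<theta> - of_real p) + cis \<theta> / (1 - of_real p * cis \<theta>)) = 0"
    by (simp only: plus_complex.sel cnj.sel add.right_inverse)
  moreover have "Re (\<i> * of_real \<theta> * ((1 + of_real p) * w)) = 0" if "Im w = 0" for w
    using that by simp
  ultimately have "Re (\<i> * of_real \<theta> * ((1 + of_real p) * (1 / (cis \<theta> - of_real p) + cis \<theta> / (1 - of_real p * cis \<theta>)))) = 0"
    by blast
  with main show ?thesis
    by (simp only: right_diff_distrib minus_complex.sel)
qed

lemma has_integral_even_half:
  fixes f :: "real \<Rightarrow> real"
  assumes f: "(f has_integral I) {-c..c}" and even: "\<And>x. f (-x) = f x" and c: "0 \<le> c"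
  shows "(f has_integral I / 2) {0..c}"
proof -
  have "f integrable_on {0..c}"
    using f c by (intro integrable_on_subinterval[OF has_integral_integrable[OF f]]) auto
  then obtain J where J: "(f has_integral J) {0..c}"
    by blast
  then have "((\<lambda>x. f (-x)) has_integral J) {-c..-0}"
    by (subst has_integral_reflect_real) auto
  then have "(f has_integral J) {-c..0}"
    by (simp add: even)
  from has_integral_combine[OF _ _ this J] c have "(f has_integral J + J) {-c..c}"
    by simp
  then have "I = J + J"
    using f has_integral_unique by blast
  with J show ?thesis
    by simp
qed

text \<open>
  On the negative radius, the polar part and its reflection contribute an elementary integrand with primitive
  \<open>P\<close>; the pole thus leaves the term \<open>(1 + p) / p * ln p\<close>, which is the residue of
  \<open>ln z / (z (Ln (1 + z) - a))\<close> at \<open>p\<close>.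
\<close>
lemma M_as_radial_integral:
  fixes a :: real
  assumes a: "0 < a" "a < ln 2"
  defines "p \<equiv> exp a - 1"
  shows "((\<lambda>t. (1 / a - 1 / (a - ln (1 - t))) / t) has_integral M a - (1 + p) / p * ln p) {0..1}"
proof -
  have p: "0 < p" "p < 1"
    using a by (simp_all add: p_def) (metis exp_less_cancel_iff exp_ln zero_less_numeral)
  obtain H :: "complex \<Rightarrow> complex" where
    H: "continuous_on (cball 0 1) H" "H holomorphic_on ball 0 1"
    and H_eq: "\<forall>z \<in> cball 0 1 - {-1, complex_of_real p}.
       H z = 1 / (Ln (1 + z) - of_real a) - (1 + of_real p) * (1 / (z - of_real p) + z / (1 - of_real p * z))"
    by (rule reflected_kernel[OF a, folded p_def])
  obtain I :: complex where
    radial: "((\<lambda>t. (H (- of_real t) - H 0) / of_real t) has_integral I) {0..1}"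
    and circle: "((\<lambda>\<theta>. \<i> * of_real \<theta> * H (cis \<theta>)) has_integral 2 * pi * I) {-pi..pi}"
    by (rule disc_sawtooth_moment[OF H])

  define m where "m = (\<lambda>x. x\<^sup>2 / (x\<^sup>2 + (ln (2 * exp (-a) * cos x))\<^sup>2))"
  have "((\<lambda>\<theta>. 2 * m (\<theta> / 2)) has_integral 2 * pi * Re I) {-pi..pi}"
  proof (rule has_integral_spike[of "{-pi, pi}"])
    show "((\<lambda>\<theta>. Re (\<i> * of_real \<theta> * H (cis \<theta>))) has_integral 2 * pi * Re I) {-pi..pi}"
      using has_integral_Re[OF circle] by simp
    fix \<theta> assume "\<theta> \<in> {-pi..pi} - {-pi, pi}"
    then have \<theta>: "\<bar>\<theta>\<bar> < pi"
      by auto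
    have "cis \<theta> \<noteq> -1"
    proof
      assume "cis \<theta> = -1"
      then have "cos \<theta> = -1"
        by (simp add: complex_eq_iff)
      moreover have "cos \<bar>\<theta>\<bar> > cos pi"
        using \<theta> by (intro cos_monotone_0_pi) auto
      ultimately show False
        by (simp add: abs_if split: if_splits)
    qed
    moreover have "cis \<theta> \<noteq> of_real p"
    proof
      assume "cis \<theta> = of_real p"
      then have "norm (cis \<theta>) = norm (complex_of_real p)"
        by simp
      then show False
        using p by simp
    qed
    ultimately show "2 * m (\<theta> / 2) = Re (\<i> * of_real \<theta> * H (cis \<theta>))"
      by (subst H_eq[rule_format]) (simp_all only: Re_kernel_on_circle[OF \<theta>] m_def, simp_all)
  qed simp
  moreover have "2 * m (- \<theta> / 2) = 2 * m (\<theta> / 2)" for \<theta>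
    by (simp add: m_def)
  ultimately have "((\<lambda>\<theta>. 2 * m (\<theta> / 2)) has_integral 2 * pi * Re I / 2) {0..pi}"
    by (rule has_integral_even_half) simp
  from has_integral_stretch_real[OF this, of 2]
  have "((\<lambda>x. 2 * m x) has_integral 2 * (pi / 4 * Re I)) {0..pi / 2}"
    by (simp add: image_divide_atLeastAtMost)
  then have "(m has_integral pi / 4 * Re I) {0..pi / 2}"
    by (subst (asm) has_integral_mult_right_iff) simp_all
  then have "integral {0..pi/2} m = pi / 4 * Re I"
    by (rule integral_unique)
  moreover have "M a = 4 / pi * integral {0..pi/2} m"
    by (simp add: M_def flip: m_def)
  ultimately have MI: "M a = Re I"
    by (simp only:) simp

  define P where "P = (\<lambda>t. (1 + p) / p * (ln (1 + p * t) - ln (t + p)))"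
  have "((\<lambda>t. (1 + p) / p * (p / (1 + p * t) - 1 / (t + p))) has_integral P 1 - P 0) {0..1}"
  proof (rule fundamental_theorem_of_calculus)
    fix t :: real assume t: "t \<in> {0..1}"
    then have "1 + p * t > 0" "t + p > 0"
      using p by (auto intro: add_pos_nonneg add_nonneg_pos)
    then show "(P has_vector_derivative (1 + p) / p * (p / (1 + p * t) - 1 / (t + p))) (at t within {0..1})"
      unfolding P_def has_real_derivative_iff_has_vector_derivative[symmetric]
      using p by (auto intro!: derivative_eq_intros)
  qed simp
  then have P: "((\<lambda>t. (1 + p) / p * (p / (1 + p * t) - 1 / (t + p))) has_integral (1 + p) / p * ln p) {0..1}"
    by (simp add: P_def add.commute)
  have "((\<lambda>t. Re ((H (- of_real t) - H 0) / of_real t)) has_integral M a) {0..1}"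
    unfolding MI by (rule has_integral_Re[OF radial])
  from has_integral_diff[OF this P] show ?thesis
  proof (rule has_integral_spike[of "{0, 1}", rotated -1])
    fix t :: real assume "t \<in> {0..1} - {0, 1}"
    then have t: "0 < t" "t < 1"
      by auto
    have pos: "1 + p * t > 0" "t + p > 0"
      using p t by (auto intro: add_pos_nonneg add_nonneg_pos)
    have "H (- of_real t) = of_real (1 / (ln (1 - t) - a) - (1 + p) * (1 / (- t - p) + - t / (1 - p * - t)))"
    proof -
      have "Ln (1 + - of_real t) = of_real (ln (1 - t))"
        using t Ln_of_real[of "1 - t"] by simp
      then show ?thesis
        using t p by (subst H_eq[rule_format]) (auto simp: complex_eq_iff)
    qed
    moreover have "H 0 = of_real (1 / (- a) - (1 + p) * (1 / (- p)))"
      using p by (subst H_eq[rule_format]) auto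
    ultimately have R: "Re ((H (- of_real t) - H 0) / of_real t) =
       ((1 / (ln (1 - t) - a) - (1 + p) * (1 / (- t - p) + - t / (1 - p * - t)))
        - (1 / (- a) - (1 + p) * (1 / (- p)))) / t"
      by (metis Re_complex_of_real of_real_diff of_real_divide)
    have N: "1 / (ln (1 - t) - a) = - (1 / (a - ln (1 - t)))"
      by (metis minus_diff_eq minus_divide_right)
    have A: "((x - (1 + p) * (1 / (- t - p) + - t / (1 - p * - t))) - (1 / (- a) - (1 + p) * (1 / (- p)))) / t
        = (1 / a + x) / t + (1 + p) / p * (p / (1 + p * t) - 1 / (t + p))" for x
    proof -
      define u where "u = 1 / (t + p)"
      define v where "v = 1 / (1 + p * t)"
      have "1 / (- t - p) = - u"
        by (metis add.commute minus_add_distrib minus_divide_right diff_conv_add_uminus u_def)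
      moreover have "- t / (1 - p * - t) = - (t * v)"
        by (simp add: v_def)
      ultimately have "(x - (1 + p) * (1 / (- t - p) + - t / (1 - p * - t))) - (1 / (- a) - (1 + p) * (1 / (- p)))
          = (1 / a + x) + (1 + p) * ((u - 1 / p) + t * v)"
        by (simp add: algebra_simps)
      also have "u - 1 / p = - (t * u / p)"
        using p pos by (simp add: u_def field_simps)
      also have "(1 / a + x) + (1 + p) * (- (t * u / p) + t * v) = (1 / a + x) + t * ((1 + p) / p * (p * v - u))"
        using p by (simp add: field_simps)
      finally have "((x - (1 + p) * (1 / (- t - p) + - t / (1 - p * - t))) - (1 / (- a) - (1 + p) * (1 / (- p)))) / t
          = ((1 / a + x) + t * ((1 + p) / p * (p * v - u))) / t"
        by (rule arg_cong)
      also have "\<dots> = (1 / a + x) / t + (1 + p) / p * (p * v - u)"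
        using t by (simp add: add_divide_distrib)
      finally show ?thesis
        by (simp add: u_def v_def)
    qed
    show "(1 / a - 1 / (a - ln (1 - t))) / t =
        Re ((H (- of_real t) - H 0) / of_real t) - (1 + p) / p * (p / (1 + p * t) - 1 / (t + p))"
      unfolding R N A by simp
  qed simp
qed

section \<open>The Laplace transform of the digamma function\<close>

lemma Digamma_plus_euler_sums:
  fixes s :: real
  assumes "0 \<le> s"
  shows "(\<lambda>k. 1 / (real k + 1) - 1 / (real k + s + 1)) sums (Digamma (s + 1) + euler_mascheroni)"
  using summable_sums[OF summable_Digamma[of "s + 1"]] assms
  by (simp add: Digamma_def inverse_eq_divide add_ac)

lemma Digamma_plus_euler_nonneg:
  fixes s :: real
  assumes "0 \<le> s"
  shows "0 \<le> Digamma (s + 1) + euler_mascheroni"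
  by (rule sums_le[OF _ sums_zero Digamma_plus_euler_sums[OF assms]])
     (use assms in \<open>auto intro!: divide_left_mono mult_pos_pos\<close>)

text \<open>
  Expand \<open>1 / (1 - y)\<close> into the geometric series and integrate termwise, which gives the series of the
  digamma function.
\<close>
lemma nn_integral_powr_quotient:
  fixes s :: real
  assumes s: "0 \<le> s"
  shows "(\<integral>\<^sup>+y. ennreal ((1 - y powr s) / (1 - y)) * indicator {0<..<1} y \<partial>lborel)
       = ennreal (Digamma (s + 1) + euler_mascheroni)"
proof -
  let ?h = "\<lambda>k y. y powr real k - y powr (real k + s)"
  have h_nonneg: "0 \<le> ?h k y" if "y \<in> {0<..<1}" for k y
    using that s by (auto intro: powr_mono')
  have "ennreal ((1 - y powr s) / (1 - y)) * indicator {0<..<1} y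
      = (\<Sum>k. ennreal (?h k y) * indicator {0<..<1} y)" for y
  proof (cases "y \<in> {0<..<1}")
    case True
    have "(\<lambda>k. y ^ k * (1 - y powr s)) sums (1 / (1 - y) * (1 - y powr s))"
      using True by (intro sums_mult2 geometric_sums) auto
    then have "(\<lambda>k. ?h k y) sums ((1 - y powr s) / (1 - y))"
      using True by (simp add: powr_add powr_realpow right_diff_distrib diff_divide_distrib)
    then have "(\<Sum>k. ennreal (?h k y)) = ennreal ((1 - y powr s) / (1 - y))"
      by (rule suminf_ennreal_eq[OF h_nonneg[OF True]])
    then show ?thesis
      by (simp only: indicator_simps(1)[OF True] mult_1_right)
  qed simp
  then have "(\<integral>\<^sup>+y. ennreal ((1 - y powr s) / (1 - y)) * indicator {0<..<1} y \<partial>lborel)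
      = (\<Sum>k. \<integral>\<^sup>+y. ennreal (?h k y) * indicator {0<..<1} y \<partial>lborel)"
    by (simp only:) (rule nn_integral_suminf, measurable)
  also have "\<dots> = (\<Sum>k. ennreal (1 / (real k + 1) - 1 / (real k + s + 1)))"
  proof (rule suminf_cong)
    fix k
    have "(?h k has_integral 1 powr (real k + 1) / (real k + 1) - 1 powr (real k + s + 1) / (real k + s + 1)) {0..1}"
      using s by (intro has_integral_diff has_integral_powr_from_0) auto
    then have "(?h k has_integral 1 / (real k + 1) - 1 / (real k + s + 1)) {0<..<1}"
      by (simp add: has_integral_Icc_iff_Ioo)
    with h_nonneg show "(\<integral>\<^sup>+y. ennreal (?h k y) * indicator {0<..<1} y \<partial>lborel)
        = ennreal (1 / (real k + 1) - 1 / (real k + s + 1))"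
      by (rule nn_integral_has_integral_lebesgue')
  qed
  also have "\<dots> = ennreal (Digamma (s + 1) + euler_mascheroni)"
    by (rule suminf_ennreal_eq[OF _ Digamma_plus_euler_sums[OF s]])
       (use s in \<open>auto intro!: divide_left_mono mult_pos_pos\<close>)
  finally show ?thesis .
qed

lemma nn_integral_exp_one_minus_powr:
  fixes a y :: real
  assumes a: "0 < a" and y: "0 < y" "y < 1"
  shows "(\<integral>\<^sup>+s. ennreal (exp (-a * s) * (1 - y powr s)) * indicator {0..} s \<partial>lborel)
       = ennreal (1 / a - 1 / (a - ln y))"
proof -
  have b: "0 < a - ln y"
    using a ln_less_zero[OF y] by simp
  define F where "F = (\<lambda>s. exp (- (a - ln y) * s) / (a - ln y) - exp (-a * s) / a)"
  have "(\<integral>\<^sup>+s. ennreal (exp (-a * s) * (1 - y powr s)) * indicator {0..} s \<partial>lborel) = ennreal (0 - F 0)"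
  proof (rule nn_integral_FTC_atLeast)
    show "(\<lambda>s. exp (-a * s) * (1 - y powr s)) \<in> borel_measurable borel"
      by measurable
    show "DERIV F s :> exp (-a * s) * (1 - y powr s)" for s
    proof -
      have "DERIV (\<lambda>s. exp (-c * s) / c) s :> - exp (-c * s)" if "0 < c" for c :: real
        using that by (auto intro!: derivative_eq_intros)
      from DERIV_diff[OF this[OF b] this[OF a]]
      have "DERIV F s :> - exp (- (a - ln y) * s) - - exp (-a * s)"
        by (simp only: F_def)
      moreover have "exp (- (a - ln y) * s) = exp (-a * s) * y powr s"
        using y by (simp add: powr_def algebra_simps flip: exp_add)
      ultimately show ?thesis
        by (simp only: right_diff_distrib) simp
    qed
    show "0 \<le> exp (-a * s) * (1 - y powr s)" if "0 \<le> s" for s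
      using that y powr_le1[of s y] by simp
    have "((\<lambda>s. exp (-c * s) / c) \<longlongrightarrow> 0) at_top" if "0 < c" for c :: real
      using that by real_asymp
    from tendsto_diff[OF this[OF b] this[OF a]] show "(F \<longlongrightarrow> 0) at_top"
      by (simp add: F_def)
  qed
  also have "0 - F 0 = 1 / a - 1 / (a - ln y)"
    by (simp add: F_def)
  finally show ?thesis .
qed

text \<open>
  Both sides are iterated integrals of \<open>e\<^sup>-\<^sup>a\<^sup>s (1 - y\<^sup>s) / (1 - y)\<close> over \<open>s \<ge> 0\<close> and
  \<open>0 < y < 1\<close>.
\<close>
lemma Laplace_Digamma_Tonelli:
  fixes a :: real
  assumes a: "0 < a"
  shows "(\<integral>\<^sup>+s. ennreal (exp (-a * s) * (Digamma (s + 1) + euler_mascheroni)) * indicator {0..} s \<partial>lborel)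
       = (\<integral>\<^sup>+y. ennreal ((1 / a - 1 / (a - ln y)) / (1 - y)) * indicator {0<..<1} y \<partial>lborel)"
proof -
  define G :: "real \<Rightarrow> real \<Rightarrow> ennreal" where
    "G = (\<lambda>s y. ennreal (exp (-a * s) * (1 - y powr s) / (1 - y)) * indicator {0..} s * indicator {0<..<1} y)"
  have "(\<integral>\<^sup>+s. ennreal (exp (-a * s) * (Digamma (s + 1) + euler_mascheroni)) * indicator {0..} s \<partial>lborel)
      = (\<integral>\<^sup>+s. (\<integral>\<^sup>+y. G s y \<partial>lborel) \<partial>lborel)"
  proof (rule nn_integral_cong)
    fix s :: real
    show "ennreal (exp (-a * s) * (Digamma (s + 1) + euler_mascheroni)) * indicator {0..} s
        = (\<integral>\<^sup>+y. G s y \<partial>lborel)"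
    proof (cases "0 \<le> s")
      case True
      have "(\<integral>\<^sup>+y. G s y \<partial>lborel)
          = (\<integral>\<^sup>+y. ennreal (exp (-a * s)) * (ennreal ((1 - y powr s) / (1 - y)) * indicator {0<..<1} y) \<partial>lborel)"
        using True by (intro nn_integral_cong) (simp add: G_def ennreal_mult' mult.assoc flip: times_divide_eq_right)
      also have "\<dots> = ennreal (exp (-a * s)) * ennreal (Digamma (s + 1) + euler_mascheroni)"
        by (subst nn_integral_cmult) (simp_all only: nn_integral_powr_quotient[OF True], measurable)
      finally show ?thesis
        using True by (simp add: ennreal_mult')
    qed (simp add: G_def)
  qed
  also have "\<dots> = (\<integral>\<^sup>+y. (\<integral>\<^sup>+s. G s y \<partial>lborel) \<partial>lborel)"
    by (rule lborel_pair.Fubini') (simp add: G_def)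
  also have "\<dots> = (\<integral>\<^sup>+y. ennreal ((1 / a - 1 / (a - ln y)) / (1 - y)) * indicator {0<..<1} y \<partial>lborel)"
  proof (rule nn_integral_cong)
    fix y :: real
    show "(\<integral>\<^sup>+s. G s y \<partial>lborel) = ennreal ((1 / a - 1 / (a - ln y)) / (1 - y)) * indicator {0<..<1} y"
    proof (cases "y \<in> {0<..<1}")
      case True
      then have y: "0 < y" "y < 1"
        by auto
      have "(\<integral>\<^sup>+s. G s y \<partial>lborel)
          = (\<integral>\<^sup>+s. ennreal (1 / (1 - y)) * (ennreal (exp (-a * s) * (1 - y powr s)) * indicator {0..} s) \<partial>lborel)"
      proof (rule nn_integral_cong)
        fix s :: real
        have "ennreal (exp (-a * s) * (1 - y powr s) / (1 - y)) = ennreal (1 / (1 - y)) * ennreal (exp (-a * s) * (1 - y powr s))"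
          using y by (subst ennreal_mult'[symmetric]) simp_all
        then show "G s y = ennreal (1 / (1 - y)) * (ennreal (exp (-a * s) * (1 - y powr s)) * indicator {0..} s)"
          using True by (simp add: G_def mult.assoc)
      qed
      also have "\<dots> = ennreal (1 / (1 - y)) * ennreal (1 / a - 1 / (a - ln y))"
        by (subst nn_integral_cmult) (simp_all only: nn_integral_exp_one_minus_powr[OF a y], measurable)
      also have "\<dots> = ennreal ((1 / a - 1 / (a - ln y)) / (1 - y))"
        using y by (subst ennreal_mult'[symmetric]) simp_all
      finally show ?thesis
        using True by simp
    qed (simp add: G_def)
  qed
  finally show ?thesis .
qed

text \<open>
  \<open>Gamma0\<close> is a gauge integral, which carries no information where it diverges; the
  finiteness of the nonnegative integral is therefore transferred to it before the two are identified.
\<close>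
lemma Gamma0_nn_integral:
  fixes a :: real
  assumes a: "0 < a" and fin: "(\<integral>\<^sup>+u. ennreal (exp (-a * u) / u) * indicator {1..} u \<partial>lborel) < \<infinity>"
  shows "(\<integral>\<^sup>+u. ennreal (exp (-a * u) / u) * indicator {1..} u \<partial>lborel) = ennreal (Gamma0 a)" "0 \<le> Gamma0 a"
proof -
  have "(\<integral>\<^sup>+u. ennreal (exp (-u) / u) * indicator {a..} u \<partial>lborel)
      = ennreal \<bar>a\<bar> * (\<integral>\<^sup>+u. ennreal (exp (- (0 + a * u)) / (0 + a * u)) * indicator {a..} (0 + a * u) \<partial>lborel)"
    by (rule nn_integral_real_affine) (use a in auto)
  also have "\<dots> = (\<integral>\<^sup>+u. ennreal a * (ennreal (exp (- (0 + a * u)) / (0 + a * u)) * indicator {a..} (0 + a * u)) \<partial>lborel)"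
    using a by (subst nn_integral_cmult) simp_all
  also have "\<dots> = (\<integral>\<^sup>+u. ennreal (exp (-a * u) / u) * indicator {1..} u \<partial>lborel)"
  proof (rule nn_integral_cong)
    fix u :: real
    have "a \<le> a * u \<longleftrightarrow> 1 \<le> u"
      using a by simp
    then show "ennreal a * (ennreal (exp (- (0 + a * u)) / (0 + a * u)) * indicator {a..} (0 + a * u))
        = ennreal (exp (-a * u) / u) * indicator {1..} u"
      using a by (cases "1 \<le> u") (simp_all flip: ennreal_mult')
  qed
  finally have eq: "(\<integral>\<^sup>+u. ennreal (exp (-u) / u) * indicator {a..} u \<partial>lborel)
      = (\<integral>\<^sup>+u. ennreal (exp (-a * u) / u) * indicator {1..} u \<partial>lborel)" .
  from fin obtain g where g: "0 \<le> g" "(\<integral>\<^sup>+u. ennreal (exp (-a * u) / u) * indicator {1..} u \<partial>lborel) = ennreal g"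
    by (auto simp: less_top_ennreal)
  have "((\<lambda>u. indicator {a..} u * (exp (-u) / u)) has_integral g) UNIV"
  proof (rule nn_integral_has_integral)
    show "0 \<le> indicator {a..} u * (exp (-u) / u)" for u :: real
      using a by (simp add: indicator_def)
    show "(\<integral>\<^sup>+u. ennreal (indicator {a..} u * (exp (-u) / u)) \<partial>lborel) = ennreal g"
      unfolding g(2)[symmetric] eq[symmetric] by (intro nn_integral_cong) (simp add: indicator_def)
  qed (use g in auto)
  moreover have "(\<lambda>u. indicator {a..} u * (exp (-u) / u)) = (\<lambda>u. if u \<in> {a..} then exp (-u) / u else 0)"
    by (auto simp: indicator_def)
  ultimately have "((\<lambda>u. exp (-u) / u) has_integral g) {a..}"
    by (simp only: has_integral_restrict_UNIV)
  then have "Gamma0 a = g"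
    unfolding Gamma0_def by (rule integral_unique)
  with g show "(\<integral>\<^sup>+u. ennreal (exp (-a * u) / u) * indicator {1..} u \<partial>lborel) = ennreal (Gamma0 a)" "0 \<le> Gamma0 a"
    by simp_all
qed

text \<open>
  Since \<open>\<psi>(s + 2) = \<psi>(s + 1) + 1 / (s + 1)\<close>, the part of the Laplace integral over \<open>s \<ge> 1\<close> is
  \<open>e\<^sup>-\<^sup>a\<close> times the whole integral plus an incomplete gamma integral. Finiteness of the whole
  integral forces finiteness of the latter, and the resulting linear equation can be solved for \<open>R\<close>.
\<close>
lemma Laplace_Digamma_split:
  fixes a R :: real
  assumes a: "0 < a" and R: "0 \<le> R"
    and X: "(\<integral>\<^sup>+s. ennreal (exp (-a * s) * (Digamma (s + 1) + euler_mascheroni)) * indicator {0..} s \<partial>lborel) = ennreal R"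
  shows "(1 - exp (-a)) * R = integral {0..1} (\<lambda>s. exp (-a * s) * (Digamma (s + 1) + euler_mascheroni)) + Gamma0 a"
proof -
  define D :: "real \<Rightarrow> real" where "D = (\<lambda>s. Digamma (s + 1) + euler_mascheroni)"
  define f where "f = (\<lambda>s. exp (-a * s) * D s)"
  define h where "h = (\<lambda>s. ennreal (f s) * indicator {0..} s)"
  have f_nonneg: "0 \<le> f s" if "0 \<le> s" for s
    using Digamma_plus_euler_nonneg[OF that] by (simp add: f_def D_def)
  have "continuous_on {0..} D"
    unfolding D_def
    by (intro continuous_intros continuous_on_compose2[OF continuous_on_Polygamma[of "{1..}"]])
       (auto elim!: nonpos_Ints_cases)
  then have cont: "continuous_on {0..} f"
    unfolding f_def by (intro continuous_intros)
  have "h = (\<lambda>s. ennreal (indicator {0..} s *\<^sub>R f s))"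
    by (auto simp: h_def indicator_def)
  then have h[measurable]: "h \<in> borel_measurable borel"
    using borel_measurable_continuous_on_indicator[OF _ cont] by simp
  have X: "(\<integral>\<^sup>+s. h s \<partial>lborel) = ennreal R"
    using X by (simp add: h_def f_def D_def)

  have "f integrable_on {0..1}"
    by (intro integrable_continuous_real continuous_on_subset[OF cont]) auto
  then have "(f has_integral integral {0..1} f) {0<..<1}"
    by (simp add: has_integral_integral has_integral_Icc_iff_Ioo)
  then have "(\<integral>\<^sup>+s. ennreal (f s) * indicator {0<..<1} s \<partial>lborel) = ennreal (integral {0..1} f)"
    by (intro nn_integral_has_integral_lebesgue') (auto intro: f_nonneg)
  moreover have "(\<integral>\<^sup>+s. ennreal (f s) * indicator {0<..<1} s \<partial>lborel) = (\<integral>\<^sup>+s. h s * indicator {..<1} s \<partial>lborel)"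
    by (intro nn_integral_cong_AE AE_I[of _ _ "{0}"]) (auto simp: h_def indicator_def)
  ultimately have low: "(\<integral>\<^sup>+s. h s * indicator {..<1} s \<partial>lborel) = ennreal (integral {0..1} f)"
    by simp

  have step: "h (1 + s) * indicator {1..} (1 + s)
      = ennreal (exp (-a)) * h s + ennreal (exp (-a * (1 + s)) / (1 + s)) * indicator {1..} (1 + s)" for s
  proof (cases "0 \<le> s")
    case True
    then have "D (1 + s) = D s + 1 / (1 + s)"
      using Digamma_plus1[of "s + 1"] by (simp add: D_def add_ac)
    moreover have "exp (-a * (1 + s)) = exp (-a) * exp (-a * s)"
      by (simp add: algebra_simps flip: exp_add)
    ultimately have "f (1 + s) = exp (-a) * f s + exp (-a * (1 + s)) / (1 + s)"
      unfolding f_def by (simp only: distrib_left mult.assoc times_divide_eq_right mult_1_right)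
    then show ?thesis
      using True f_nonneg[OF True] by (simp add: h_def ennreal_mult')
  qed (simp add: h_def)
  have "(\<integral>\<^sup>+s. h s * indicator {1..} s \<partial>lborel) = (\<integral>\<^sup>+s. h (1 + 1 * s) * indicator {1..} (1 + 1 * s) \<partial>lborel)"
    using nn_integral_real_affine[of "\<lambda>s. h s * indicator {1..} s" 1 1] by simp
  also have "\<dots> = (\<integral>\<^sup>+s. ennreal (exp (-a)) * h s \<partial>lborel)
      + (\<integral>\<^sup>+s. ennreal (exp (-a * (1 + s)) / (1 + s)) * indicator {1..} (1 + s) \<partial>lborel)"
    unfolding mult_1 step by (rule nn_integral_add) simp_all
  also have "(\<integral>\<^sup>+s. ennreal (exp (-a)) * h s \<partial>lborel) = ennreal (exp (-a) * R)"
    using R by (simp add: nn_integral_cmult X ennreal_mult')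
  also have "(\<integral>\<^sup>+s. ennreal (exp (-a * (1 + s)) / (1 + s)) * indicator {1..} (1 + s) \<partial>lborel)
      = (\<integral>\<^sup>+u. ennreal (exp (-a * u) / u) * indicator {1..} u \<partial>lborel)" (is "_ = ?g")
    using nn_integral_real_affine[of "\<lambda>u. ennreal (exp (-a * u) / u) * indicator {1..} u" 1 1] by simp
  finally have high: "(\<integral>\<^sup>+s. h s * indicator {1..} s \<partial>lborel) = ennreal (exp (-a) * R) + ?g" .

  have "ennreal R = (\<integral>\<^sup>+s. h s * indicator {..<1} s + h s * indicator {1..} s \<partial>lborel)"
    unfolding X[symmetric] by (intro nn_integral_cong) (auto simp: indicator_def)
  also have "\<dots> = ennreal (integral {0..1} f) + (ennreal (exp (-a) * R) + ?g)"
    by (subst nn_integral_add) (simp_all only: low high, measurable)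
  finally have eq: "ennreal R = ennreal (integral {0..1} f) + (ennreal (exp (-a) * R) + ?g)" .
  have "?g \<le> ennreal R"
    unfolding eq by (simp add: add_increasing)
  then have "?g < \<infinity>"
    by (simp add: le_less_trans)
  note g = Gamma0_nn_integral[OF a this]
  have I: "0 \<le> integral {0..1} f"
    by (intro integral_nonneg \<open>f integrable_on {0..1}\<close>) (auto intro: f_nonneg)
  have "ennreal R = ennreal (integral {0..1} f + (exp (-a) * R + Gamma0 a))"
    using eq I R g by simp
  then have "R = integral {0..1} f + (exp (-a) * R + Gamma0 a)"
    using I R g by (subst (asm) ennreal_inj) auto
  then show ?thesis
    by (simp add: f_def D_def algebra_simps)
qed

section \<open>The evaluation of the integral\<close>

theorem corollary2p1:
  fixes a :: real
  assumes "0 < a" and "a < ln 2"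
  shows "M a = euler_mascheroni / a
           + (a + ln (1 - exp (-a)) + Gamma0 a) / (1 - exp (-a))
           + 1 / (1 - exp (-a)) * integral {0..1} (\<lambda>t. exp (-a * t) * Digamma (t + 1))"
proof -
  define q where "q = 1 - exp (-a)"
  define R where "R = M a - (1 + (exp a - 1)) / (exp a - 1) * ln (exp a - 1)"
  define j where "j = (\<lambda>y. (1 / a - 1 / (a - ln y)) / (1 - y))"
  have q: "0 < q"
    using assms by (simp add: q_def)
  have p: "exp a - 1 = exp a * q"
    by (simp add: q_def right_diff_distrib flip: exp_add)
  then have p': "1 + exp a * q = exp a"
    by linarith
  have "R = M a - exp a / (exp a * q) * ln (exp a * q)"
    by (simp only: R_def p p')
  then have R_eq: "R = M a - (a + ln q) / q"
    using q by (simp add: ln_mult)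

  \<comment> \<open>The substitution \<open>t = 1 - y\<close> in the radial integral.\<close>
  have "((\<lambda>y. (1 / a - 1 / (a - ln (1 - (- 1 *\<^sub>R y + 1)))) / (- 1 *\<^sub>R y + 1)) has_integral
      (1 / (\<bar>- 1\<bar> ^ DIM(real))) *\<^sub>R R)
      ((\<lambda>y. (1 / - 1) *\<^sub>R y + - ((1 / - 1) *\<^sub>R 1)) ` cbox 0 1)"
    using M_as_radial_integral[OF assms]
    by (intro has_integral_affinity) (simp_all add: R_def)
  moreover have "(\<lambda>y. (1 / - 1) *\<^sub>R y + - ((1 / - 1) *\<^sub>R 1)) ` cbox 0 1 = {0..1::real}"
    using image_affinity_atLeastAtMost[of "- 1" 1 0 "1 :: real"] by simp
  ultimately have "(j has_integral R) {0..1}"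
    by (simp add: j_def)
  then have j: "(j has_integral R) {0<..<1}"
    by (simp add: has_integral_Icc_iff_Ioo)
  have j_nonneg: "0 \<le> j y" if "y \<in> {0<..<1}" for y
  proof -
    have "a \<le> a - ln y" "0 < a - ln y"
      using that assms(1) ln_less_zero[of y] unfolding greaterThanLessThan_iff by linarith+
    then have "1 / (a - ln y) \<le> 1 / a"
      using assms(1) by (intro divide_left_mono mult_pos_pos) auto
    then show ?thesis
      using that by (simp add: j_def)
  qed
  have R: "0 \<le> R"
    by (rule has_integral_nonneg[OF j j_nonneg])
  have "(\<integral>\<^sup>+s. ennreal (exp (-a * s) * (Digamma (s + 1) + euler_mascheroni)) * indicator {0..} s \<partial>lborel)
      = ennreal R"
    using nn_integral_has_integral_lebesgue'[OF j_nonneg j]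
    by (simp only: Laplace_Digamma_Tonelli[OF assms(1)] j_def)
  from Laplace_Digamma_split[OF assms(1) R this]
  have "q * R = integral {0..1} (\<lambda>s. exp (-a * s) * (Digamma (s + 1) + euler_mascheroni)) + Gamma0 a"
    by (simp only: q_def)
  also have "integral {0..1} (\<lambda>s. exp (-a * s) * (Digamma (s + 1) + euler_mascheroni))
      = integral {0..1} (\<lambda>s. exp (-a * s) * Digamma (s + 1)) + euler_mascheroni * (q / a)"
  proof -
    have "continuous_on {0..1} (\<lambda>s. Digamma (s + 1) :: real)"
      by (intro continuous_on_compose2[OF continuous_on_Polygamma[of "{1..}"]] continuous_intros)
         (auto elim!: nonpos_Ints_cases)
    then have "(\<lambda>s. exp (-a * s) * Digamma (s + 1)) integrable_on {0..1}"
      by (intro integrable_continuous_real continuous_intros)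
    moreover have "((\<lambda>s. euler_mascheroni * exp (-a * s)) has_integral
        euler_mascheroni * (- exp (-a * 1) / a - - exp (-a * 0) / a)) {0..1}"
      using assms
      by (intro has_integral_mult_right fundamental_theorem_of_calculus)
         (auto intro!: derivative_eq_intros simp flip: has_real_derivative_iff_has_vector_derivative)
    ultimately have "((\<lambda>s. exp (-a * s) * Digamma (s + 1) + euler_mascheroni * exp (-a * s)) has_integral
        integral {0..1} (\<lambda>s. exp (-a * s) * Digamma (s + 1))
        + euler_mascheroni * (- exp (-a * 1) / a - - exp (-a * 0) / a)) {0..1}"
      by (intro has_integral_add) (simp_all add: has_integral_integral)
    then show ?thesis
      by (intro integral_unique) (simp add: q_def distrib_left mult.commute diff_divide_distrib)
  qed
  finally have "R = (integral {0..1} (\<lambda>s. exp (-a * s) * Digamma (s + 1)) + euler_mascheroni * (q / a) + Gamma0 a) / q"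
    using q by (simp add: eq_divide_eq mult.commute)
  also have "\<dots> = euler_mascheroni / a + (Gamma0 a) / q
      + 1 / q * integral {0..1} (\<lambda>s. exp (-a * s) * Digamma (s + 1))"
    using q by (simp add: add_divide_distrib)
  finally show ?thesis
    using R_eq by (simp add: add_divide_distrib q_def)
qed

end
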